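(* Let $\mathbb{K}$ be a symmetric cone of dimension greater than or equal to $2$ in a finite-dimensional real inner product space $(\mathbb{E},\bullet)$. Then for every $c$ generating an extreme ray of $\mathbb{K}$, the set $\mathbb{R}_+(c\otimes c) = \{\alpha\,(c\otimes c) \mid \alpha \ge 0\}$ is a non-exposed face of the copositive cone $\mathcal{COP}(\mathbb{K})$ (that is, it is a face of $\mathcal{COP}(\mathbb{K})$ and it is not exposed). In particular, $\mathcal{COP}(\mathbb{K})$ is not facially exposed.
   Context: Cones. Let $(\mathbb{V},\bullet)$ be a finite-dimensional real inner product space. A set $\mathbb{K}\subseteq\mathbb{V}$ is a cone if $\alpha x\in\mathbb{K}$ for all $\alpha>0$ and $x\in\mathbb{K}$. Its dual cone is $\mathbb{K}^* = \{x\in\mathbb{V} \mid x\bullet y\ge 0 \text{ for all } y\in\mathbb{K}\}$. The dimension of a convex cone is the dimension of its linear span. Symmetric cones. A closed cone $\mathbb{K}$ in a finite-dimensional real inner product space $(\mathbb{E},\bullet)$ is symmetric if (i) $\mathbb{K}^*=\mathbb{K}$, and (ii) for all $x,y$ in the interior of $\mathbb{K}$ there is a bijective linear transformation $\mathcal{G}$ of $\mathbb{E}$ with $\mathcal{G}(\mathbb{K})=\mathbb{K}$ and $\mathcal{G}(x)=y$. (By self-duality, $\mathbb{K}$ spans $\mathbb{E}$.) Copositive cones. $\mathcal{S}(\mathbb{E})$ denotes the space of self-adjoint linear transformations on $\mathbb{E}$, equipped with the trace inner product $\langle\mathcal{A},\mathcal{B}\rangle = \mathrm{tr}(\mathcal{A}\circ\mathcal{B})$.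 For a closed cone $\mathbb{K}\subseteq\mathbb{E}$, the copositive cone over $\mathbb{K}$ is $\mathcal{COP}(\mathbb{K}) = \{\mathcal{A}\in\mathcal{S}(\mathbb{E}) \mid x\bullet\mathcal{A}(x)\ge 0 \text{ for all } x\in\mathbb{K}\}$, a closed convex cone in $\mathcal{S}(\mathbb{E})$. For $a,b\in\mathbb{E}$, $a\otimes b$ is the linear map on $\mathbb{E}$ given by $(a\otimes b)(x) = (b\bullet x)\,a$. Faces. Let $\mathbb{K}$ be a closed convex cone in a finite-dimensional real inner product space (this applies both to symmetric cones in $\mathbb{E}$ and to $\mathcal{COP}(\mathbb{K})$ in $\mathcal{S}(\mathbb{E})$). A nonempty convex subcone $\mathbb{F}$ of $\mathbb{K}$ is a face of $\mathbb{K}$ if for all $a,b\in\mathbb{K}$, $a+b\in\mathbb{F}$ implies $a,b\in\mathbb{F}$. A nonzero $x\in\mathbb{K}$ generates an extreme ray of $\mathbb{K}$ if $\mathbb{R}_+x = \{\alpha x\mid\alpha\ge 0\}$ is a face of $\mathbb{K}$. A face $\mathbb{F}$ of $\mathbb{K}$ is exposed if there exists $h\in\mathbb{K}^*$ such that $\mathbb{F}=\mathbb{K}\cap\{h\}^\perp$, where $\{h\}^\perp$ is the set of elements orthogonal to $h$ and the dual cone is taken in the ambient inner product space. $\mathbb{K}$ is facially exposed if all its faces are exposed. *)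

theory Defs
  imports "HOL-Analysis.Analysis"
begin

text \<open>
  Finite-dimensional inner product spaces occur in two forms below: the Euclidean space
  \<open>E\<close> itself (a type of class \<open>euclidean_space\<close>) and the space of self-adjoint
  transformations with the trace inner product, which is a subspace of \<open>E \<Rightarrow>\<^sub>L E\<close>.
  The notions that depend on the ambient space and its inner product therefore take
  the carrier \<open>V\<close> and the inner product \<open>ip\<close> as arguments.
\<close>

text \<open>Only positive scalars are required, unlike in the library's \<open>cone\<close>.\<close>

definition is_cone :: "'v::real_vector set \<Rightarrow> bool"
  where "is_cone K \<longleftrightarrow> (\<forall>x\<in>K. \<forall>\<alpha>>0. \<alpha> *\<^sub>R x \<in> K)"

definition dual_cone :: "'v set \<Rightarrow> ('v \<Rightarrow> 'v \<Rightarrow> real) \<Rightarrow> 'v set \<Rightarrow> 'v set"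
  where "dual_cone V ip K = {x\<in>V. \<forall>y\<in>K. ip x y \<ge> 0}"

definition symmetric_cone :: "'a::euclidean_space set \<Rightarrow> bool"
  where "symmetric_cone K \<longleftrightarrow>
    closed K \<and> is_cone K \<and> dual_cone UNIV (\<bullet>) K = K \<and>
    (\<forall>x\<in>interior K. \<forall>y\<in>interior K. \<exists>G. linear G \<and> bij G \<and> G ` K = K \<and> G x = y)"

text \<open>This is the algebraic notion for cones, with sums in place of the open segments
  used by the library's \<open>face_of\<close>; the empty set is not a face.\<close>

definition is_face :: "'v::real_vector set \<Rightarrow> 'v set \<Rightarrow> bool"
  where "is_face K F \<longleftrightarrow>
    F \<noteq> {} \<and> F \<subseteq> K \<and> convex F \<and> is_cone F \<and>
    (\<forall>a\<in>K. \<forall>b\<in>K. a + b \<in> F \<longrightarrow> a \<in> F \<and> b \<in> F)"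

definition ray :: "'v::real_vector \<Rightarrow> 'v set"
  where "ray x = {\<alpha> *\<^sub>R x | \<alpha>. \<alpha> \<ge> 0}"

definition generates_extreme_ray :: "'v::real_vector set \<Rightarrow> 'v \<Rightarrow> bool"
  where "generates_extreme_ray K x \<longleftrightarrow> x \<in> K \<and> x \<noteq> 0 \<and> is_face K (ray x)"

definition is_exposed_face ::
    "'v::real_vector set \<Rightarrow> ('v \<Rightarrow> 'v \<Rightarrow> real) \<Rightarrow> 'v set \<Rightarrow> 'v set \<Rightarrow> bool"
  where "is_exposed_face V ip K F \<longleftrightarrow>
    is_face K F \<and> (\<exists>h\<in>dual_cone V ip K. F = K \<inter> {x\<in>V. ip h x = 0})"

definition facially_exposed ::
    "'v::real_vector set \<Rightarrow> ('v \<Rightarrow> 'v \<Rightarrow> real) \<Rightarrow> 'v set \<Rightarrow> bool"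
  where "facially_exposed V ip K \<longleftrightarrow> (\<forall>F. is_face K F \<longrightarrow> is_exposed_face V ip K F)"

text \<open>On a Euclidean space every linear map is bounded, so \<open>'a \<Rightarrow>\<^sub>L 'a\<close> is the space of all
  linear transformations.\<close>

definition selfadjoint :: "('a::euclidean_space \<Rightarrow>\<^sub>L 'a) set"
  where "selfadjoint = {A. \<forall>x y. blinfun_apply A x \<bullet> y = x \<bullet> blinfun_apply A y}"

text \<open>The trace, computed in the orthonormal basis \<open>Basis\<close>.\<close>

definition tr :: "('a::euclidean_space \<Rightarrow>\<^sub>L 'a) \<Rightarrow> real"
  where "tr A = (\<Sum>b\<in>Basis. blinfun_apply A b \<bullet> b)"

text \<open>An inner product on the subspace \<open>selfadjoint\<close> only.\<close>

definition trace_inner :: "('a::euclidean_space \<Rightarrow>\<^sub>L 'a) \<Rightarrow> ('a \<Rightarrow>\<^sub>L 'a) \<Rightarrow> real"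
  where "trace_inner A B = tr (A o\<^sub>L B)"

definition copositive_cone :: "'a::euclidean_space set \<Rightarrow> ('a \<Rightarrow>\<^sub>L 'a) set"
  where "copositive_cone K = {A\<in>selfadjoint. \<forall>x\<in>K. x \<bullet> blinfun_apply A x \<ge> 0}"

lift_definition tensor :: "'a::euclidean_space \<Rightarrow> 'a \<Rightarrow> 'a \<Rightarrow>\<^sub>L 'a"
  is "\<lambda>a b x. (b \<bullet> x) *\<^sub>R a"
  by (intro bounded_linear_scaleR_const bounded_linear_inner_right)

end

theory Submission imports Defs begin

text \<open>
  Self-duality makes \<open>K\<close> a convex cone that spans the space. The face property is a statement
  about such a cone and an extreme ray \<open>c\<close> of its dual.
  Suppose \<open>A + B = \<alpha> (c \<otimes> c)\<close> with \<open>A\<close> and \<open>B\<close> copositive. At a point \<open>x\<close> of \<open>K\<close>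
  orthogonal to \<open>c\<close> both quadratic forms vanish, hence attain their minimum over \<open>K\<close>, so \<open>A x\<close> and
  \<open>B x\<close> lie in the dual cone; their sum is \<open>0\<close>, and both are \<open>0\<close>. The difficulty is that there may
  be few such points: the common kernel \<open>N\<close> of \<open>A\<close>, \<open>B\<close> and \<open>c \<bullet> _\<close> has to be shown to be the
  whole hyperplane orthogonal to \<open>c\<close>. Both forms are invariant under translation by \<open>N\<close>, so the
  minimum argument also applies to the larger cone \<open>S = closure (K + N)\<close>. It shows that \<open>S\<close>
  meets the hyperplane exactly in \<open>N\<close>. Modulo \<open>N\<close> the functional \<open>c\<close> is then strictly positive on
  a closed cone and remains nonnegative under small perturbations; for an extreme \<open>c\<close> this leaves
  no room unless \<open>N\<close> is a hyperplane (\<open>orthogonal_to_extreme_ray_subset\<close>). A self-adjoint map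
  that vanishes on this hyperplane is a multiple of \<open>c \<otimes> c\<close> (\<open>copositive_summand_of_rank_one\<close>).

  The face is not exposed because every \<open>H\<close> in the dual of the copositive cone is positive
  semidefinite. If \<open>H\<close> is orthogonal to \<open>c \<otimes> c\<close>, then \<open>H c = 0\<close>, so \<open>H\<close> is also orthogonal to the
  copositive map \<open>c \<otimes> d + d \<otimes> c\<close>, where \<open>d\<close> is an element of \<open>K\<close> that is not a multiple of \<open>c\<close>
  (\<open>ray_tensor_not_exposed\<close>). It remains to know that \<open>K\<close> has an extreme ray at all
  (\<open>extreme_ray_exists\<close>), so that a non-exposed face is actually present.
\<close>

section \<open>Dual cones and extreme rays\<close>

lemma mem_dual_cone_UNIV: "x \<in> dual_cone UNIV (\<bullet>) K \<longleftrightarrow> (\<forall>y\<in>K. x \<bullet> y \<ge> 0)"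
  by (simp add: dual_cone_def)

lemma dual_cone_pointed:
  fixes K :: "'a::euclidean_space set"
  assumes "span K = UNIV"
    and "x \<in> dual_cone UNIV (\<bullet>) K" and "- x \<in> dual_cone UNIV (\<bullet>) K"
  shows "x = 0"
proof -
  have "\<forall>y\<in>K. orthogonal x y"
    using assms(2,3) by (force simp: mem_dual_cone_UNIV orthogonal_def)
  then have "orthogonal x y" if "y \<in> span K" for y
    using orthogonal_to_span that by blast
  then show ?thesis
    using assms(1) orthogonal_self by blast
qed

lemma self_dual_span:
  fixes K :: "'a::euclidean_space set"
  assumes "dual_cone UNIV (\<bullet>) K = K"
  shows "span K = UNIV"
proof (rule ccontr)
  assume "span K \<noteq> UNIV"
  then obtain a where a: "a \<noteq> 0" "\<forall>x \<in> span K. a \<bullet> x = 0"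
    using span_not_UNIV_orthogonal[of K] by auto
  then have "a \<in> K"
    using assms mem_dual_cone_UNIV[of a K] by (simp add: span_base)
  then show False
    using a span_base by fastforce
qed

lemma self_dual_convex_cone:
  fixes K :: "'a::euclidean_space set"
  assumes "dual_cone UNIV (\<bullet>) K = K"
  shows "convex_cone K"
proof -
  have "convex_cone (dual_cone UNIV (\<bullet>) K)"
    by (simp add: convex_cone_iff mem_dual_cone_UNIV inner_add_left)
  then show ?thesis
    using assms by simp
qed

text \<open>A sum of vectors spanning the space and taken from the cone is a strictly positive
  functional: an element on which it vanishes is orthogonal to each of them.\<close>

lemma self_dual_strictly_positive:
  fixes K :: "'a::euclidean_space set"
  assumes "dual_cone UNIV (\<bullet>) K = K"
  obtains e where "\<And>x. x \<in> K \<Longrightarrow> x \<noteq> 0 \<Longrightarrow> e \<bullet> x > 0"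
proof -
  have K: "x \<bullet> y \<ge> 0" if "x \<in> K" "y \<in> K" for x y
    using assms mem_dual_cone_UNIV that by blast
  obtain B where B: "B \<subseteq> K" "independent B" "K \<subseteq> span B"
    by (metis maximal_independent_subset)
  have fin: "finite B"
    using B(2) independent_imp_finite by blast
  have "(\<Sum>b\<in>B. b) \<bullet> x > 0" if x: "x \<in> K" "x \<noteq> 0" for x
  proof -
    have nonneg: "\<And>b. b \<in> B \<Longrightarrow> 0 \<le> b \<bullet> x"
      using B(1) K x(1) by blast
    have "\<exists>b\<in>B. b \<bullet> x \<noteq> 0"
    proof (rule ccontr)
      assume "\<not> ?thesis"
      then have "\<And>b. b \<in> B \<Longrightarrow> orthogonal x b"
        by (simp add: orthogonal_def inner_commute)
      then have "orthogonal x x"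
        using orthogonal_to_span[of x B] B(3) x(1) by blast
      then show False
        using x(2) by (simp add: orthogonal_self)
    qed
    then obtain b where "b \<in> B" "0 < b \<bullet> x"
      using nonneg by force
    then have "0 < (\<Sum>b\<in>B. b \<bullet> x)"
      using fin nonneg by (intro sum_pos2[where i = b]) auto
    then show ?thesis
      by (simp add: inner_sum_left)
  qed
  then show thesis
    using that by blast
qed

lemma mem_ray: "x \<in> ray y \<longleftrightarrow> (\<exists>\<alpha>\<ge>0. x = \<alpha> *\<^sub>R y)"
  by (auto simp: ray_def)

lemma is_face_ray:
  assumes "\<And>\<alpha>. \<alpha> \<ge> 0 \<Longrightarrow> \<alpha> *\<^sub>R x \<in> K"
    and "\<And>a b. a \<in> K \<Longrightarrow> b \<in> K \<Longrightarrow> a + b \<in> ray x \<Longrightarrow> a \<in> ray x"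
  shows "is_face K (ray x)"
proof -
  have "convex (ray x)"
    unfolding convex_def mem_ray
  proof (intro ballI allI impI)
    fix y z and u v :: real
    assume "y \<in> ray x" "z \<in> ray x" "0 \<le> u" "0 \<le> v" "u + v = 1"
    then obtain s t where "0 \<le> s" "y = s *\<^sub>R x" "0 \<le> t" "z = t *\<^sub>R x"
      by (auto simp: mem_ray)
    then show "\<exists>\<alpha>\<ge>0. u *\<^sub>R y + v *\<^sub>R z = \<alpha> *\<^sub>R x"
      using \<open>0 \<le> u\<close> \<open>0 \<le> v\<close>
      by (intro exI[of _ "u * s + v * t"]) (simp add: scaleR_add_left)
  qed
  moreover have "is_cone (ray x)"
    unfolding is_cone_def mem_ray
  proof (intro ballI allI impI)
    fix y and t :: real
    assume "y \<in> ray x" "t > 0"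
    then obtain s where "s \<ge> 0" "y = s *\<^sub>R x"
      by (auto simp: mem_ray)
    then show "\<exists>\<alpha>\<ge>0. t *\<^sub>R y = \<alpha> *\<^sub>R x"
      using \<open>t > 0\<close> by (intro exI[of _ "t * s"]) simp
  qed
  moreover have "ray x \<noteq> {}" "ray x \<subseteq> K"
    using assms(1) by (auto simp: ray_def)
  moreover have "a \<in> ray x \<and> b \<in> ray x" if "a \<in> K" "b \<in> K" "a + b \<in> ray x" for a b
    using assms(2)[of a b] assms(2)[of b a] that by (simp add: add.commute)
  ultimately show ?thesis
    by (simp add: is_face_def)
qed

text \<open>A unit vector \<open>c\<close> of the cone at which a strictly positive functional is least
  generates an extreme ray. With minimum \<open>m\<close>, a decomposition \<open>c = a + b\<close> gives
  \<open>m = e \<bullet> a + e \<bullet> b \<ge> m (\<parallel>a\<parallel> + \<parallel>b\<parallel>) \<ge> m\<close>, so the triangle inequality is an equality and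
  \<open>a\<close>, \<open>b\<close> are multiples of \<open>c\<close>.\<close>

lemma extreme_ray_exists:
  fixes K :: "'a::euclidean_space set"
  assumes "closed K" and cone: "convex_cone K" and "x \<in> K" "x \<noteq> 0"
    and pos: "\<And>x. x \<in> K \<Longrightarrow> x \<noteq> 0 \<Longrightarrow> e \<bullet> x > 0"
  obtains c where "generates_extreme_ray K c"
proof -
  have "compact (K \<inter> sphere 0 1)"
    using \<open>closed K\<close> by (simp add: closed_Int_compact)
  moreover have "inverse (norm x) *\<^sub>R x \<in> K \<inter> sphere 0 1"
    using assms(3,4) convex_cone_scaleR[OF cone] by simp
  moreover have "continuous_on (K \<inter> sphere 0 1) ((\<bullet>) e)"
    by (intro continuous_intros)
  ultimately obtain c where c: "c \<in> K" "norm c = 1"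
    and min: "\<And>y. y \<in> K \<Longrightarrow> norm y = 1 \<Longrightarrow> e \<bullet> c \<le> e \<bullet> y"
    using continuous_attains_inf[of "K \<inter> sphere 0 1" "(\<bullet>) e"]
    by (metis IntD1 IntD2 IntI empty_iff mem_sphere_0)
  have m: "e \<bullet> c > 0"
    using pos c by force
  have bound: "(e \<bullet> c) * norm y \<le> e \<bullet> y" if "y \<in> K" for y
  proof (cases "y = 0")
    case False
    then have "e \<bullet> c \<le> e \<bullet> (inverse (norm y) *\<^sub>R y)"
      using that convex_cone_scaleR[OF cone] by (intro min) auto
    with False show ?thesis
      by (simp add: field_simps)
  qed auto
  have "a \<in> ray c" if a: "a \<in> K" and b: "b \<in> K" and ab: "a + b \<in> ray c" for a b
  proof -
    obtain \<alpha> where \<alpha>: "\<alpha> \<ge> 0" "a + b = \<alpha> *\<^sub>R c"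
      using ab by (auto simp: mem_ray)
    have "(e \<bullet> c) * (norm a + norm b) \<le> e \<bullet> (a + b)"
      using bound[OF a] bound[OF b] by (simp add: inner_add_right distrib_left)
    also have "\<dots> = (e \<bullet> c) * norm (a + b)"
      using \<alpha> c by simp
    finally have "norm (a + b) = norm a + norm b"
      using m norm_triangle_ineq[of a b] by simp
    then have eq: "norm a *\<^sub>R b = norm b *\<^sub>R a" and n: "\<alpha> = norm a + norm b"
      using \<alpha> c norm_triangle_eq[of a b] by simp_all
    have "\<alpha> *\<^sub>R a = norm a *\<^sub>R (a + b)"
      using eq n by (simp add: scaleR_add_left scaleR_add_right)
    then have "\<alpha> *\<^sub>R a = \<alpha> *\<^sub>R norm a *\<^sub>R c"
      using \<alpha>(2) by (simp add: mult.commute)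
    then have "\<alpha> = 0 \<or> a = norm a *\<^sub>R c"
      by (metis scaleR_cancel_left)
    then have "a = norm a *\<^sub>R c"
      using n by (auto simp: add_nonneg_eq_0_iff)
    then show ?thesis
      using mem_ray norm_ge_zero by blast
  qed
  then have "is_face K (ray c)"
    using c(1) convex_cone_scaleR[OF cone] by (intro is_face_ray) auto
  then show thesis
    using that c by (force simp: generates_extreme_ray_def)
qed

text \<open>Since the functional \<open>c\<close> is positive on \<open>S\<close> outside the subspace \<open>N\<close>, a compactness argument
  modulo \<open>N\<close> shows that \<open>c\<close> stays in the dual cone of \<open>S\<close>, hence in that of \<open>K\<close>,
  when it is moved slightly in any direction \<open>v\<close> orthogonal to \<open>N\<close>. Writing \<open>2 c\<close> as \<open>(c + \<epsilon> v) + (c - \<epsilon> v)\<close>, extremality forces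
  \<open>v\<close> to be a multiple of \<open>c\<close>. The claim is this inclusion passed to orthogonal complements.\<close>

lemma orthogonal_to_extreme_ray_subset:
  fixes S :: "'a::euclidean_space set"
  assumes "closed S" and cone: "convex_cone S" and "subspace N" "N \<subseteq> S" "K \<subseteq> S"
    and pos: "\<And>x. x \<in> S \<Longrightarrow> x \<notin> N \<Longrightarrow> c \<bullet> x > 0"
    and orth: "\<And>x. x \<in> N \<Longrightarrow> c \<bullet> x = 0"
    and ext: "generates_extreme_ray (dual_cone UNIV (\<bullet>) K) c"
  shows "{x. c \<bullet> x = 0} \<subseteq> N"
proof -
  have "v \<in> span {c}" if v: "v \<in> N\<^sup>\<bottom>" for v
  proof -
    define T where "T = S \<inter> N\<^sup>\<bottom> \<inter> sphere 0 1"
    have "compact T"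
      unfolding T_def
      by (intro closed_Int_compact closed_Int \<open>closed S\<close> closed_subspace
          subspace_orthogonal_comp compact_sphere)
    have Tpos: "c \<bullet> x > 0" if "x \<in> T" for x
    proof (rule pos)
      show "x \<notin> N"
        using that by (auto simp: T_def orthogonal_comp_def orthogonal_def)
    qed (use that T_def in auto)
    obtain \<delta> where \<delta>: "\<delta> > 0" "\<And>x. x \<in> T \<Longrightarrow> \<delta> \<le> c \<bullet> x"
    proof (cases "T = {}")
      case False
      moreover have "continuous_on T ((\<bullet>) c)"
        by (intro continuous_intros)
      ultimately obtain x where "x \<in> T" "\<forall>y\<in>T. c \<bullet> x \<le> c \<bullet> y"
        using continuous_attains_inf[OF \<open>compact T\<close>] by blast
      then show thesis
        using Tpos that[of "c \<bullet> x"] by blast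
    qed (use that[of 1] in auto)
    \<comment> \<open>The summand \<open>1\<close> covers \<open>v = 0\<close>.\<close>
    define \<epsilon> where "\<epsilon> = \<delta> / (norm v + 1)"
    have \<epsilon>: "\<epsilon> > 0" "\<epsilon> * norm v \<le> \<delta>"
      using \<delta>(1) by (auto simp: \<epsilon>_def field_simps add_pos_nonneg)
    have dual: "c + s *\<^sub>R v \<in> dual_cone UNIV (\<bullet>) K" if s: "\<bar>s\<bar> = \<epsilon>" for s
      unfolding mem_dual_cone_UNIV
    proof
      fix x assume "x \<in> K"
      then have "x \<in> S"
        using \<open>K \<subseteq> S\<close> by blast
      obtain n y where ny: "x = n + y" "n \<in> N" "y \<in> N\<^sup>\<bottom>"
        using subspace_sum_orthogonal_comp[OF \<open>subspace N\<close>] by (metis UNIV_I set_plus_elim)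
      have "- n \<in> S"
        using ny(2) assms(3,4) subspace_neg by blast
      then have y: "y \<in> S"
        using convex_cone_add[OF cone \<open>x \<in> S\<close>, of "- n"] ny(1) by simp
      have vn: "v \<bullet> n = 0"
        using v ny(2) by (simp add: orthogonal_comp_def orthogonal_def inner_commute)
      have "(c + s *\<^sub>R v) \<bullet> y \<ge> 0"
      proof (cases "y = 0")
        case False
        define z where "z = inverse (norm y) *\<^sub>R y"
        have "z \<in> T"
          using False y ny(3) convex_cone_scaleR[OF cone]
          by (simp add: T_def z_def subspace_scale[OF subspace_orthogonal_comp])
        have "\<bar>s * (v \<bullet> z)\<bar> \<le> \<epsilon> * norm v"
          using Cauchy_Schwarz_ineq2[of v z] \<open>z \<in> T\<close> \<epsilon>(1) s
          by (auto simp: abs_mult T_def intro: mult_left_mono)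
        then have "0 \<le> (c + s *\<^sub>R v) \<bullet> z"
          using \<delta>(2)[OF \<open>z \<in> T\<close>] \<epsilon>(2) by (simp add: inner_add_left)
        then show ?thesis
          using False by (simp add: z_def zero_le_mult_iff)
      qed auto
      then show "0 \<le> (c + s *\<^sub>R v) \<bullet> x"
        using ny orth vn by (simp add: inner_add_left inner_add_right)
    qed
    have "(c + \<epsilon> *\<^sub>R v) + (c + (- \<epsilon>) *\<^sub>R v) = 2 *\<^sub>R c"
      by (simp add: scaleR_2)
    then have "(c + \<epsilon> *\<^sub>R v) + (c + (- \<epsilon>) *\<^sub>R v) \<in> ray c"
      using mem_ray[of "2 *\<^sub>R c" c] by (metis zero_le_numeral)
    then have "c + \<epsilon> *\<^sub>R v \<in> ray c"
      using ext dual[of \<epsilon>] dual[of "- \<epsilon>"] \<epsilon>(1)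
      unfolding generates_extreme_ray_def is_face_def by simp
    then obtain \<beta> where "c + \<epsilon> *\<^sub>R v = \<beta> *\<^sub>R c"
      by (auto simp: mem_ray)
    then have "\<epsilon> *\<^sub>R v = (\<beta> - 1) *\<^sub>R c"
      by (simp add: algebra_simps)
    then have "v = (inverse \<epsilon> * (\<beta> - 1)) *\<^sub>R c"
      using \<epsilon>(1) by (metis scaleR_scaleR left_inverse less_irrefl scaleR_one)
    then show ?thesis
      by (metis span_base span_scale singletonI)
  qed
  then have "{x. c \<bullet> x = 0} \<subseteq> N\<^sup>\<bottom>\<^sup>\<bottom>"
    by (fastforce simp: orthogonal_comp_def[of "N\<^sup>\<bottom>"] orthogonal_def span_singleton)
  then show ?thesis
    using orthogonal_comp_self[OF \<open>subspace N\<close>] by simp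
qed


section \<open>Rank-one faces of the copositive cone\<close>

lemma tensor_apply [simp]: "blinfun_apply (tensor a b) x = (b \<bullet> x) *\<^sub>R a"
  by transfer simp

lemma selfadjointD: "A \<in> selfadjoint \<Longrightarrow> blinfun_apply A x \<bullet> y = x \<bullet> blinfun_apply A y"
  by (simp add: selfadjoint_def)

lemma scale_tensor_copositive:
  assumes "\<alpha> \<ge> 0"
  shows "\<alpha> *\<^sub>R tensor c c \<in> copositive_cone K"
  using assms
  by (simp add: copositive_cone_def selfadjoint_def blinfun.scaleR_left inner_commute mult.assoc)

text \<open>A quadratic form that is nonnegative on the half-line from \<open>x\<close> in direction \<open>y\<close> and
  vanishes at \<open>x\<close> has nonnegative derivative there.\<close>

lemma quadratic_form_zero_derivative:
  fixes A :: "'a::euclidean_space \<Rightarrow>\<^sub>L 'a"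
  assumes "A \<in> selfadjoint" "x \<bullet> A x = 0"
    and nonneg: "\<And>t. t > 0 \<Longrightarrow> (x + t *\<^sub>R y) \<bullet> A (x + t *\<^sub>R y) \<ge> 0"
  shows "A x \<bullet> y \<ge> 0"
proof (rule ccontr)
  assume neg: "\<not> ?thesis"
  define q where "q = y \<bullet> A y"
  \<comment> \<open>The form at \<open>x + t y\<close> is \<open>t (2 (A x \<bullet> y) + t q)\<close>; this \<open>t\<close> is small enough for the linear
    term to dominate, and the summand \<open>1\<close> covers \<open>q = 0\<close>.\<close>
  define t where "t = - (A x \<bullet> y) / (\<bar>q\<bar> + 1)"
  have "t > 0"
    using neg by (simp add: t_def divide_neg_pos)
  have "t * \<bar>q\<bar> < - (A x \<bullet> y)"
    using neg \<open>t > 0\<close> by (simp add: t_def field_simps)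
  moreover have "t * q \<le> t * \<bar>q\<bar>"
    using \<open>t > 0\<close> by simp
  ultimately have "2 * (A x \<bullet> y) + t * q < 0"
    using neg by linarith
  moreover have "(x + t *\<^sub>R y) \<bullet> A (x + t *\<^sub>R y) = t * (2 * (A x \<bullet> y) + t * q)"
    using assms(2) selfadjointD[OF assms(1), of x y]
    by (simp add: q_def blinfun.add_right blinfun.scaleR_right inner_add_left inner_add_right
        algebra_simps inner_commute)
  ultimately show False
    using nonneg[OF \<open>t > 0\<close>] mult_pos_neg[OF \<open>t > 0\<close>] by (metis not_less)
qed

lemma selfadjoint_vanishing_on_hyperplane:
  fixes A :: "'a::euclidean_space \<Rightarrow>\<^sub>L 'a"
  assumes "A \<in> selfadjoint" "c \<noteq> 0"
    and zero: "\<And>x. c \<bullet> x = 0 \<Longrightarrow> A x = 0"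
  obtains \<beta> where "A = \<beta> *\<^sub>R tensor c c"
proof -
  define \<beta> where "\<beta> = (c \<bullet> A c) / (c \<bullet> c)\<^sup>2"
  have dec: "A x = ((c \<bullet> x) / (c \<bullet> c)) *\<^sub>R A c" for x
  proof -
    have "A (x - ((c \<bullet> x) / (c \<bullet> c)) *\<^sub>R c) = 0"
      using assms(2) by (intro zero) (simp add: inner_diff_right)
    then show ?thesis
      by (simp add: blinfun.diff_right blinfun.scaleR_right)
  qed
  have "A c = ((c \<bullet> A c) / (c \<bullet> c)) *\<^sub>R c"
  proof (rule vector_eq_rdot[THEN iffD1], rule allI)
    fix z
    have "A c \<bullet> z = c \<bullet> A z"
      using assms(1) by (rule selfadjointD)
    then show "A c \<bullet> z = ((c \<bullet> A c) / (c \<bullet> c)) *\<^sub>R c \<bullet> z"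
      by (simp add: dec[of z])
  qed
  then have eq: "A x = ((c \<bullet> x) / (c \<bullet> c)) *\<^sub>R ((c \<bullet> A c) / (c \<bullet> c)) *\<^sub>R c" for x
    using dec[of x] by (simp only:)
  have "A = \<beta> *\<^sub>R tensor c c"
  proof (rule blinfun_eqI)
    fix x
    show "A x = (\<beta> *\<^sub>R tensor c c) x"
      unfolding eq[of x]
      by (simp add: \<beta>_def blinfun.scaleR_left power2_eq_square mult.commute)
  qed
  then show thesis
    by (rule that)
qed

text \<open>Let \<open>A + B = \<alpha> (c \<otimes> c)\<close> with both summands copositive, and let \<open>N\<close> be the common kernel
  of \<open>A\<close>, \<open>B\<close> and the functional \<open>c\<close>. Adding elements of \<open>N\<close> to an argument changes neither
  quadratic form, so both are nonnegative on \<open>S = closure (K + N)\<close>. If \<open>x \<in> S\<close> is orthogonal to \<open>c\<close>,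
  both forms vanish at \<open>x\<close>, so their derivatives \<open>A x\<close> and \<open>B x\<close> lie in the dual cone;
  as they add up to \<open>0\<close> and that cone is pointed, \<open>x \<in> N\<close>. Hence \<open>c\<close> is positive on \<open>S - N\<close>, and
  extremality of \<open>c\<close> makes \<open>N\<close> the whole hyperplane orthogonal to \<open>c\<close>.\<close>

lemma copositive_summand_of_rank_one:
  fixes K :: "'a::euclidean_space set"
  assumes cone: "convex_cone K" and "span K = UNIV"
    and ext: "generates_extreme_ray (dual_cone UNIV (\<bullet>) K) c"
    and A: "A \<in> copositive_cone K" and B: "B \<in> copositive_cone K"
    and sum: "A + B = \<alpha> *\<^sub>R tensor c c"
  shows "A \<in> ray (tensor c c)"
proof -
  have cK: "c \<bullet> x \<ge> 0" if "x \<in> K" for x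
    using ext that by (simp add: generates_extreme_ray_def mem_dual_cone_UNIV)
  have "c \<noteq> 0"
    using ext by (simp add: generates_extreme_ray_def)
  have sa: "A \<in> selfadjoint" "B \<in> selfadjoint"
    using A B by (simp_all add: copositive_cone_def)
  have AB: "A x + B x = (\<alpha> * (c \<bullet> x)) *\<^sub>R c" for x
    using sum by (metis blinfun.add_left blinfun.scaleR_left scaleR_scaleR tensor_apply)
  define N where "N = {x. A x = 0 \<and> B x = 0 \<and> c \<bullet> x = 0}"
  have "subspace N"
    by (simp add: subspace_def N_def blinfun.add_right blinfun.scaleR_right inner_add_right)
  define S where "S = closure (K + N)"
  have KN: "convex_cone (K + N)"
  proof -
    have "K + N = (\<Union>x\<in>K. \<Union>y\<in>N. {x + y})"
      by (auto simp: set_plus_def)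
    then show ?thesis
      using convex_cone_sums[OF cone subspace_imp_convex_cone[OF \<open>subspace N\<close>]] by simp
  qed
  have S: "convex_cone S"
    using KN by (simp add: S_def convex_cone_def convex_closure conic_closure)
  have "K \<subseteq> S"
    using subspace_0[OF \<open>subspace N\<close>] closure_subset[of "K + N"] set_plus_intro[of _ K 0 N]
    by (auto simp: S_def)
  have "N \<subseteq> S"
    using convex_cone_contains_0[OF cone] closure_subset[of "K + N"] set_plus_intro[of 0 K _ N]
    by (auto simp: S_def)
  have form: "x \<bullet> C x \<ge> 0" if C: "C \<in> copositive_cone K" "\<And>n. n \<in> N \<Longrightarrow> C n = 0" and "x \<in> S"
    for x C
  proof (rule continuous_ge_on_closure[of "K + N" "\<lambda>x. x \<bullet> C x" x 0])
    show "continuous_on (closure (K + N)) (\<lambda>x. x \<bullet> C x)"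
      by (intro continuous_intros)
    show "0 \<le> y \<bullet> C y" if "y \<in> K + N" for y
    proof -
      obtain k n where kn: "y = k + n" "k \<in> K" "n \<in> N"
        using \<open>y \<in> K + N\<close> by (rule set_plus_elim)
      have "n \<bullet> C k = C n \<bullet> k"
        using C(1) by (simp add: copositive_cone_def selfadjointD)
      then have "y \<bullet> C y = k \<bullet> C k"
        using kn C(2) by (simp add: blinfun.add_right inner_add_left)
      then show ?thesis
        using C(1) kn(2) by (simp add: copositive_cone_def)
    qed
  qed (use that S_def in auto)
  have formA: "x \<bullet> A x \<ge> 0" and formB: "x \<bullet> B x \<ge> 0" if "x \<in> S" for x
    using form[OF A _ that] form[OF B _ that] by (simp_all add: N_def)
  have inN: "x \<in> N" if x: "x \<in> S" "c \<bullet> x = 0" for x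
  proof -
    have "x \<bullet> A x + x \<bullet> B x = 0"
      using AB[of x] x(2) by (simp flip: inner_add_right)
    then have zero: "x \<bullet> A x = 0" "x \<bullet> B x = 0"
      using formA[OF x(1)] formB[OF x(1)] by linarith+
    have move: "x + t *\<^sub>R y \<in> S" if "y \<in> K" "t > 0" for y and t :: real
      using that x(1) \<open>K \<subseteq> S\<close> S by (simp add: convex_cone_add convex_cone_scaleR subsetD)
    have "A x \<in> dual_cone UNIV (\<bullet>) K" "B x \<in> dual_cone UNIV (\<bullet>) K"
      unfolding mem_dual_cone_UNIV
      using quadratic_form_zero_derivative sa zero move formA formB by blast+
    moreover have "B x = - A x"
      using AB[of x] x(2) by (simp add: eq_neg_iff_add_eq_0 add.commute)
    ultimately have "A x = 0" "B x = 0"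
      using dual_cone_pointed[OF \<open>span K = UNIV\<close>] by auto
    then show ?thesis
      using x(2) by (simp add: N_def)
  qed
  have cS: "c \<bullet> x \<ge> 0" if "x \<in> S" for x
  proof (rule continuous_ge_on_closure[of "K + N" "(\<bullet>) c" x 0])
    show "continuous_on (closure (K + N)) ((\<bullet>) c)"
      by (intro continuous_intros)
    show "0 \<le> c \<bullet> y" if "y \<in> K + N" for y
      using that cK by (auto elim!: set_plus_elim simp: N_def inner_add_right)
  qed (use that S_def in auto)
  have "{x. c \<bullet> x = 0} \<subseteq> N"
  proof (rule orthogonal_to_extreme_ray_subset[OF _ S \<open>subspace N\<close> \<open>N \<subseteq> S\<close> \<open>K \<subseteq> S\<close> _ _ ext])
    show "0 < c \<bullet> x" if "x \<in> S" "x \<notin> N" for x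
      using cS inN that by (metis order_le_less)
  qed (auto simp: S_def N_def)
  then have "A x = 0" if "c \<bullet> x = 0" for x
    using that by (auto simp: N_def)
  then obtain \<beta> where \<beta>: "A = \<beta> *\<^sub>R tensor c c"
    using selfadjoint_vanishing_on_hyperplane[OF sa(1) \<open>c \<noteq> 0\<close>] by blast
  obtain x where x: "x \<in> K" "c \<bullet> x \<noteq> 0"
    using dual_cone_pointed[OF \<open>span K = UNIV\<close>, of c] \<open>c \<noteq> 0\<close>
    by (fastforce simp: mem_dual_cone_UNIV)
  have "0 \<le> x \<bullet> A x"
    using A x(1) by (simp add: copositive_cone_def)
  also have "\<dots> = \<beta> * (c \<bullet> x)\<^sup>2"
    by (simp add: \<beta> blinfun.scaleR_left inner_commute power2_eq_square)
  finally have "\<beta> \<ge> 0"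
    using x(2) by (simp add: zero_le_mult_iff)
  then show ?thesis
    using \<beta> mem_ray by blast
qed

lemma is_face_ray_tensor:
  fixes K :: "'a::euclidean_space set"
  assumes "convex_cone K" "span K = UNIV"
    and "generates_extreme_ray (dual_cone UNIV (\<bullet>) K) c"
  shows "is_face (copositive_cone K) (ray (tensor c c))"
proof (rule is_face_ray)
  show "\<alpha> *\<^sub>R tensor c c \<in> copositive_cone K" if "\<alpha> \<ge> 0" for \<alpha>
    using that by (rule scale_tensor_copositive)
  show "A \<in> ray (tensor c c)"
    if "A \<in> copositive_cone K" "B \<in> copositive_cone K" "A + B \<in> ray (tensor c c)" for A B
    using copositive_summand_of_rank_one[OF assms that(1,2)] that(3) by (auto simp: mem_ray)
qed


section \<open>Non-exposedness\<close>

lemma trace_inner_tensor: "trace_inner A (tensor a b) = A a \<bullet> b"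
proof -
  have "trace_inner A (tensor a b) = (\<Sum>i\<in>Basis. (A a \<bullet> i) * (b \<bullet> i))"
    by (simp add: trace_inner_def tr_def blinfun.scaleR_right mult.commute)
  then show ?thesis
    using euclidean_inner[of "A a" b] by simp
qed

lemma trace_inner_add_right: "trace_inner A (B + C) = trace_inner A B + trace_inner A C"
  by (simp add: trace_inner_def tr_def blinfun.add_left blinfun.add_right inner_add_left sum.distrib)

text \<open>All squares \<open>v \<otimes> v\<close> are copositive, so an element of the dual of the copositive cone is a
  positive semidefinite map. Being orthogonal to \<open>c \<otimes> c\<close> then puts \<open>c\<close> into its kernel.\<close>

lemma dual_copositive_kernel:
  assumes H: "H \<in> dual_cone selfadjoint trace_inner (copositive_cone K)"
    and "trace_inner H (tensor c c) = 0"
  shows "H c = 0"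
proof -
  have sa: "H \<in> selfadjoint"
    using H by (simp add: dual_cone_def)
  have psd: "v \<bullet> H v \<ge> 0" for v
  proof -
    have "tensor v v \<in> copositive_cone K"
      using scale_tensor_copositive[of 1 v K] by simp
    then show ?thesis
      using H by (auto simp: dual_cone_def trace_inner_tensor inner_commute)
  qed
  have zero: "c \<bullet> H c = 0"
    using assms(2) by (simp add: trace_inner_tensor inner_commute)
  \<comment> \<open>The form is nonnegative everywhere, so the direction \<open>- H c\<close> of steepest descent is allowed.\<close>
  have "H c \<bullet> (- H c) \<ge> 0"
    using quadratic_form_zero_derivative[OF sa zero psd] .
  then show ?thesis
    by (metis inner_ge_zero inner_minus_right inner_eq_zero_iff neg_0_le_iff_le order_antisym)
qed

text \<open>If \<open>H\<close> in the dual of the copositive cone is orthogonal to \<open>c \<otimes> c\<close>, its inner product with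
  \<open>D = c \<otimes> d + d \<otimes> c\<close> is \<open>2 (d \<bullet> H c) = 0\<close>. The map \<open>D\<close> is copositive, since \<open>c\<close> and \<open>d\<close> are
  nonnegative on \<open>K\<close>, but it is not a multiple of \<open>c \<otimes> c\<close>: otherwise evaluation at \<open>c\<close> would make
  \<open>d\<close> a multiple of \<open>c\<close>.\<close>

lemma ray_tensor_not_exposed:
  fixes K :: "'a::euclidean_space set"
  assumes c: "c \<in> dual_cone UNIV (\<bullet>) K" "c \<noteq> 0"
    and d: "d \<in> dual_cone UNIV (\<bullet>) K" "d \<notin> span {c}"
  shows "\<not> is_exposed_face selfadjoint trace_inner (copositive_cone K) (ray (tensor c c))"
proof
  assume "is_exposed_face selfadjoint trace_inner (copositive_cone K) (ray (tensor c c))"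
  then obtain H where H: "H \<in> dual_cone selfadjoint trace_inner (copositive_cone K)"
    and F: "ray (tensor c c) = copositive_cone K \<inter> {x \<in> selfadjoint. trace_inner H x = 0}"
    by (auto simp: is_exposed_face_def)
  have "tensor c c \<in> ray (tensor c c)"
    unfolding mem_ray by (metis scaleR_one zero_le_one)
  then have Hc: "H c = 0"
    using F dual_copositive_kernel[OF H] by blast
  define D where "D = tensor c d + tensor d c"
  have sa: "D \<in> selfadjoint"
    by (simp add: D_def selfadjoint_def blinfun.add_left inner_add_left inner_add_right inner_commute)
  have "D \<in> copositive_cone K"
    using sa c(1) d(1)
    by (simp add: D_def copositive_cone_def mem_dual_cone_UNIV blinfun.add_left inner_add_right
        inner_commute)
  moreover have "trace_inner H D = 0"
  proof -
    have "H d \<bullet> c = d \<bullet> H c"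
      using H by (simp add: dual_cone_def selfadjointD)
    then show ?thesis
      using Hc by (simp add: D_def trace_inner_add_right trace_inner_tensor)
  qed
  ultimately have "D \<in> ray (tensor c c)"
    using F sa by blast
  then obtain \<alpha> where "D = \<alpha> *\<^sub>R tensor c c"
    by (auto simp: mem_ray)
  then have "D c = (\<alpha> *\<^sub>R tensor c c) c"
    by simp
  then have "(c \<bullet> c) *\<^sub>R d = (\<alpha> * (c \<bullet> c) - d \<bullet> c) *\<^sub>R c"
    by (simp add: D_def blinfun.add_left blinfun.scaleR_left algebra_simps)
  moreover have "(\<alpha> * (c \<bullet> c) - d \<bullet> c) *\<^sub>R c \<in> span {c}"
    by (simp add: span_base span_scale)
  ultimately have "inverse (c \<bullet> c) *\<^sub>R (c \<bullet> c) *\<^sub>R d \<in> span {c}"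
    by (metis span_scale)
  then show False
    using c(2) d(2) by simp
qed

theorem theorem3p3:
  fixes K :: "'a::euclidean_space set"
  assumes "symmetric_cone K"
    and "dim (span K) \<ge> 2"
  shows "(\<forall>c. generates_extreme_ray K c \<longrightarrow>
            is_face (copositive_cone K) (ray (tensor c c)) \<and>
            \<not> is_exposed_face selfadjoint trace_inner (copositive_cone K) (ray (tensor c c)))
       \<and> \<not> facially_exposed selfadjoint trace_inner (copositive_cone K)"
proof -
  have "closed K" and dual: "dual_cone UNIV (\<bullet>) K = K"
    using assms(1) by (simp_all add: symmetric_cone_def)
  note cone = self_dual_convex_cone[OF dual]
  have notin: "\<exists>d\<in>K. d \<notin> span {c}" for c
  proof (rule ccontr)
    assume "\<not> ?thesis"
    then have "dim K \<le> card {c}"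
      by (intro dim_le_card) auto
    then show False
      using assms(2) by simp
  qed
  have main: "is_face (copositive_cone K) (ray (tensor c c)) \<and>
      \<not> is_exposed_face selfadjoint trace_inner (copositive_cone K) (ray (tensor c c))"
    if c: "generates_extreme_ray K c" for c
  proof
    show "is_face (copositive_cone K) (ray (tensor c c))"
      using is_face_ray_tensor[OF cone self_dual_span[OF dual]] c dual by simp
    obtain d where "d \<in> K" "d \<notin> span {c}"
      using notin by blast
    then show "\<not> is_exposed_face selfadjoint trace_inner (copositive_cone K) (ray (tensor c c))"
      using ray_tensor_not_exposed[of c K d] c dual by (simp add: generates_extreme_ray_def)
  qed
  obtain x where "x \<in> K" "x \<noteq> 0"
    using notin[of 0] by auto
  then obtain c where "generates_extreme_ray K c"
    using self_dual_strictly_positive[OF dual] extreme_ray_exists[OF \<open>closed K\<close> cone] by metis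
  then show ?thesis
    using main by (auto simp: facially_exposed_def)
qed

end
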